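(* Let $m_{\mathsf b}, m_{\mathsf w}$ be positive integers and let $b_0, w_0$ be integers. Consider the Pólya urn with balls of two colours, black ($\mathsf b$) and white ($\mathsf w$), in which, if a ball of colour $i\in\{\mathsf b,\mathsf w\}$ is drawn, it is replaced together with $m_i$ additional balls of the same colour. Let $B_n$ and $W_n$ be the numbers of black and white balls after $n$ draws, with initial conditions $B_0=b_0$ and $W_0=w_0$. Suppose that $m_{\mathsf b}\ge m_{\mathsf w}$ and that $b_0>w_0\ge 0$. Then $$\mathbb P\bigl(B_n>W_n \text{ for all } n\ge 0\bigr)>0.$$
   Context: The Pólya urn evolves in discrete time. At each step one ball is drawn uniformly at random from the balls currently in the urn (independently of the past given the current composition); if the drawn ball has colour $i$, it is returned to the urn together with $m_i$ additional balls of colour $i$. Thus $(B_n,W_n)_{n\ge0}$ is the Markov chain started at $(b_0,w_0)$ with transition probabilities $$\mathbb P\bigl((B_{n+1},W_{n+1})=(b+m_{\mathsf b},w)\mid (B_n,W_n)=(b,w)\bigr)=\frac{b}{b+w},$$ $$\mathbb P\bigl((B_{n+1},W_{n+1})=(b,w+m_{\mathsf w})\mid (B_n,W_n)=(b,w)\bigr)=\frac{w}{b+w}.$$ *)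

theory Defs
  imports "HOL-Probability.Probability"
begin

text \<open>
  A process \<open>(B, W)\<close> on a probability space \<open>M\<close> is a two-colour Polya urn with replacement numbers
  \<open>m_b\<close>, \<open>m_w\<close> started at \<open>(b0, w0)\<close>. The transition probabilities are prescribed conditionally on the
  whole past \<open>(B 0, W 0) = (b 0, w 0), \<dots>, (B n, W n) = (b n, w n)\<close>, so that the Markov property is
  included. They are required only for pasts of positive probability, because \<^const>\<open>cond_prob\<close>
  is 0 when the conditioning event is null.
\<close>

locale polya_urn = prob_space M
  for M :: "'a measure" +
  fixes m_b m_w b0 w0 :: int
    and B W :: "nat \<Rightarrow> 'a \<Rightarrow> int"
  assumes measurable_B: "\<And>n. B n \<in> measurable M (count_space UNIV)"
    and measurable_W: "\<And>n. W n \<in> measurable M (count_space UNIV)"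
    and initial: "AE \<omega> in M. B 0 \<omega> = b0 \<and> W 0 \<omega> = w0"
    and draw_black: "\<And>n b w. \<P>(\<omega> in M. \<forall>k\<le>n. B k \<omega> = b k \<and> W k \<omega> = w k) > 0 \<Longrightarrow>
      \<P>(\<omega> in M. B (Suc n) \<omega> = b n + m_b \<and> W (Suc n) \<omega> = w n
        \<bar> \<forall>k\<le>n. B k \<omega> = b k \<and> W k \<omega> = w k)
      = real_of_int (b n) / real_of_int (b n + w n)"
    and draw_white: "\<And>n b w. \<P>(\<omega> in M. \<forall>k\<le>n. B k \<omega> = b k \<and> W k \<omega> = w k) > 0 \<Longrightarrow>
      \<P>(\<omega> in M. B (Suc n) \<omega> = b n \<and> W (Suc n) \<omega> = w n + m_w
        \<bar> \<forall>k\<le>n. B k \<omega> = b k \<and> W k \<omega> = w k)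
      = real_of_int (w n) / real_of_int (b n + w n)"

end

theory Submission
  imports Defs
begin

text \<open>
  The share of white balls, \<open>w / (b + w)\<close>, is a nonnegative supermartingale as soon as
  \<open>m_w \<le> m_b\<close>: with equal replacement numbers it is a martingale, and adding further black balls
  after a black draw can only lower it (\<open>white_share_supermartingale\<close>). By the maximal
  inequality, the probability that the white share ever reaches \<open>1/2\<close>, that is, that black ever
  loses its strict majority, is at most \<open>2 * w0 / (b0 + w0)\<close>, and this is less than \<open>1\<close> because
  \<open>w0 < b0\<close>.

  The urn is specified by its transition probabilities given complete histories. The maximal
  inequality is therefore derived directly, without a filtration, by induction on the number of
  remaining draws: given any history ending in \<open>(b, w)\<close>, the probability of a loss of majority
  within the next \<open>N\<close> draws is at most \<open>2 * w / (b + w)\<close> (\<open>lose_majority_within_le\<close>). The bound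
  does not depend on \<open>N\<close>, so it survives the limit \<open>N \<rightarrow> \<infinity>\<close>.
\<close>

text \<open>
  The inequality reduces to \<open>b / (b + w + m_b) \<le> b / (b + w + m_w)\<close>; it is an equality when the two
  replacement numbers agree.
\<close>

lemma white_share_supermartingale:
  fixes b w m_b m_w :: real
  assumes "0 \<le> b" "0 \<le> w" "0 < b + w" "0 < m_w" "m_w \<le> m_b"
  shows "b / (b + w) * (w / (b + m_b + w)) + w / (b + w) * ((w + m_w) / (b + (w + m_w)))
    \<le> w / (b + w)"
proof -
  have "b / (b + m_b + w) + (w + m_w) / (b + (w + m_w))
      \<le> b / (b + (w + m_w)) + (w + m_w) / (b + (w + m_w))"
    using assms by (intro add_right_mono divide_left_mono mult_pos_pos) auto
  also have "\<dots> = 1"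
    using assms by (simp flip: add_divide_distrib)
  finally have "w / (b + w) * (b / (b + m_b + w) + (w + m_w) / (b + (w + m_w))) \<le> w / (b + w) * 1"
    using assms by (intro mult_left_mono) auto
  then show ?thesis
    by (simp add: algebra_simps)
qed

context polya_urn
begin

definition history :: "nat \<Rightarrow> (nat \<Rightarrow> int) \<Rightarrow> (nat \<Rightarrow> int) \<Rightarrow> 'a set" where
  "history n b w = {\<omega> \<in> space M. \<forall>k\<le>n. B k \<omega> = b k \<and> W k \<omega> = w k}"

definition lose_majority_within :: "nat \<Rightarrow> nat \<Rightarrow> 'a set" where
  "lose_majority_within n N = {\<omega> \<in> space M. \<exists>k\<le>N. B (n + k) \<omega> \<le> W (n + k) \<omega>}"

lemma measurable_counts [measurable]:
  "B n \<in> measurable M (count_space UNIV)" "W n \<in> measurable M (count_space UNIV)"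
  by (rule measurable_B, rule measurable_W)

lemma sets_history [measurable]: "history n b w \<in> sets M"
  unfolding history_def by measurable

lemma sets_lose_majority_within [measurable]: "lose_majority_within n N \<in> sets M"
  unfolding lose_majority_within_def by measurable

lemma history_fun_upd_Suc:
  "history (Suc n) (b(Suc n := x)) (w(Suc n := y))
    = {\<omega> \<in> space M. (B (Suc n) \<omega> = x \<and> W (Suc n) \<omega> = y) \<and> (\<forall>k\<le>n. B k \<omega> = b k \<and> W k \<omega> = w k)}"
  unfolding history_def by (auto simp: le_Suc_eq)

lemma prob_history_black:
  assumes "prob (history n b w) > 0"
  shows "prob (history (Suc n) (b(Suc n := b n + m_b)) (w(Suc n := w n)))
    = real_of_int (b n) / real_of_int (b n + w n) * prob (history n b w)"
  using draw_black[of n b w] assms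
  unfolding history_fun_upd_Suc unfolding history_def
  by (simp add: cond_prob_def field_simps)

lemma prob_history_white:
  assumes "prob (history n b w) > 0"
  shows "prob (history (Suc n) (b(Suc n := b n)) (w(Suc n := w n + m_w)))
    = real_of_int (w n) / real_of_int (b n + w n) * prob (history n b w)"
  using draw_white[of n b w] assms
  unfolding history_fun_upd_Suc unfolding history_def
  by (simp add: cond_prob_def field_simps)

text \<open>
  The two transition probabilities add up to \<open>1\<close>, so almost every continuation of a history is a
  black draw or a white draw. This allows conditioning on the next draw.
\<close>

lemma prob_history_Int_le:
  assumes "0 < m_b" "b n + w n > 0" "A \<in> sets M" and pos: "prob (history n b w) > 0"
  shows "prob (history n b w \<inter> A)
    \<le> prob (history (Suc n) (b(Suc n := b n + m_b)) (w(Suc n := w n)) \<inter> A)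
      + prob (history (Suc n) (b(Suc n := b n)) (w(Suc n := w n + m_w)) \<inter> A)"
proof -
  let ?H = "history n b w"
  let ?X = "history (Suc n) (b(Suc n := b n + m_b)) (w(Suc n := w n))"
  let ?Y = "history (Suc n) (b(Suc n := b n)) (w(Suc n := w n + m_w))"
  have sub: "?X \<union> ?Y \<subseteq> ?H" and disj: "?X \<inter> ?Y = {}"
    using \<open>0 < m_b\<close> by (auto simp: history_fun_upd_Suc history_def)
  have "prob (?X \<union> ?Y) = prob ?X + prob ?Y"
    using disj by (intro finite_measure_Union) auto
  also have "\<dots> = (real_of_int (b n) + real_of_int (w n)) / real_of_int (b n + w n) * prob ?H"
    unfolding prob_history_black[OF pos] prob_history_white[OF pos]
    by (simp only: add_divide_distrib distrib_right)
  also have "\<dots> = prob ?H"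
    using \<open>b n + w n > 0\<close> by (simp flip: of_int_add)
  finally have "prob (?H - (?X \<union> ?Y)) = 0"
    using sub by (subst finite_measure_Diff) auto
  have "prob (?H \<inter> A) \<le> prob ((?X \<inter> A) \<union> (?Y \<inter> A) \<union> (?H - (?X \<union> ?Y)))"
    using \<open>A \<in> sets M\<close> by (intro finite_measure_mono) auto
  also have "\<dots> \<le> prob ((?X \<inter> A) \<union> (?Y \<inter> A)) + prob (?H - (?X \<union> ?Y))"
    using \<open>A \<in> sets M\<close> by (intro measure_Un_le) auto
  also have "\<dots> \<le> prob (?X \<inter> A) + prob (?Y \<inter> A) + prob (?H - (?X \<union> ?Y))"
    using \<open>A \<in> sets M\<close> by (intro add_right_mono measure_Un_le) auto
  finally show ?thesis
    using \<open>prob (?H - (?X \<union> ?Y)) = 0\<close> by simp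
qed

text \<open>
  This is the maximal inequality for the white share, conditionally on a history. Once the majority
  is lost the right-hand side is at least the probability of the history; before that, the induction
  hypothesis for the two possible next states combines with the supermartingale property.
\<close>

lemma lose_majority_within_le:
  assumes "0 < m_w" "m_w \<le> m_b" "0 \<le> b n" "0 \<le> w n" "0 < b n + w n"
  shows "prob (history n b w \<inter> lose_majority_within n N)
    \<le> 2 * (real_of_int (w n) / real_of_int (b n + w n)) * prob (history n b w)"
  using assms(3-5)
proof (induction N arbitrary: n b w)
  case (0 n b w)
  show ?case
  proof (cases "b n \<le> w n")
    case True
    then have "1 \<le> 2 * (real_of_int (w n) / real_of_int (b n + w n))"
      using 0 by (simp add: field_simps)
    then have "prob (history n b w)
        \<le> 2 * (real_of_int (w n) / real_of_int (b n + w n)) * prob (history n b w)"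
      using mult_right_mono[OF _ measure_nonneg] by fastforce
    then show ?thesis
      by (rule order_trans[rotated]) (intro finite_measure_mono; auto)
  next
    case False
    then have "history n b w \<inter> lose_majority_within n 0 = {}"
      by (auto simp: history_def lose_majority_within_def)
    then show ?thesis
      using 0 by simp
  qed
next
  case (Suc N n b w)
  let ?H = "history n b w"
  let ?s = "real_of_int (b n + w n)"
  let ?b1 = "b(Suc n := b n + m_b)" and ?w1 = "w(Suc n := w n)"
  let ?b2 = "b(Suc n := b n)" and ?w2 = "w(Suc n := w n + m_w)"
  let ?L = "lose_majority_within (Suc n) N"
  show ?case
  proof (cases "b n \<le> w n \<or> prob ?H = 0")
    case True
    then have "prob ?H \<le> 2 * (real_of_int (w n) / ?s) * prob ?H"
    proof
      assume "b n \<le> w n"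
      then have "1 \<le> 2 * (real_of_int (w n) / ?s)"
        using Suc.prems by (simp add: field_simps)
      then show ?thesis
        using mult_right_mono[OF _ measure_nonneg] by fastforce
    qed simp
    then show ?thesis
      by (rule order_trans[rotated]) (intro finite_measure_mono; auto)
  next
    case False
    then have pos: "prob ?H > 0" and "w n < b n"
      by (auto simp: zero_less_measure_iff)
    have "?H \<inter> lose_majority_within n (Suc N) \<subseteq> ?H \<inter> ?L"
    proof
      fix \<omega> assume \<omega>: "\<omega> \<in> ?H \<inter> lose_majority_within n (Suc N)"
      then obtain k where k: "k \<le> Suc N" "B (n + k) \<omega> \<le> W (n + k) \<omega>"
        by (auto simp: lose_majority_within_def)
      have "B n \<omega> = b n" "W n \<omega> = w n"
        using \<omega> by (auto simp: history_def)
      then have "k \<noteq> 0"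
        using k(2) \<open>w n < b n\<close> by (intro notI) simp
      then obtain j where "k = Suc j"
        by (cases k) auto
      then show "\<omega> \<in> ?H \<inter> ?L"
        using \<omega> k by (auto simp: lose_majority_within_def intro!: exI[of _ j])
    qed
    then have "prob (?H \<inter> lose_majority_within n (Suc N)) \<le> prob (?H \<inter> ?L)"
      by (intro finite_measure_mono) auto
    also have "\<dots> \<le> prob (history (Suc n) ?b1 ?w1 \<inter> ?L) + prob (history (Suc n) ?b2 ?w2 \<inter> ?L)"
      using assms Suc.prems pos by (intro prob_history_Int_le) auto
    also have "\<dots> \<le> 2 * (real_of_int (w n) / real_of_int (b n + m_b + w n))
          * prob (history (Suc n) ?b1 ?w1)
        + 2 * (real_of_int (w n + m_w) / real_of_int (b n + (w n + m_w)))
          * prob (history (Suc n) ?b2 ?w2)"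
      using Suc.IH[of ?b1 "Suc n" ?w1, unfolded fun_upd_same]
        Suc.IH[of ?b2 "Suc n" ?w2, unfolded fun_upd_same] Suc.prems assms(1,2)
      by (intro add_mono) linarith+
    also have "\<dots> = 2 * (real_of_int (b n) / ?s * (real_of_int (w n) / real_of_int (b n + m_b + w n))
        + real_of_int (w n) / ?s * (real_of_int (w n + m_w) / real_of_int (b n + (w n + m_w))))
          * prob ?H"
      unfolding prob_history_black[OF pos] prob_history_white[OF pos] by (simp add: algebra_simps)
    also have "\<dots> \<le> 2 * (real_of_int (w n) / ?s) * prob ?H"
      using white_share_supermartingale[of "b n" "w n" m_w m_b] Suc.prems assms(1,2)
      by (intro mult_right_mono mult_left_mono) auto
    finally show ?thesis .
  qed
qed

lemma prob_lose_majority_le: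
  assumes "0 < m_w" "m_w \<le> m_b" "0 \<le> b0" "0 \<le> w0" "0 < b0 + w0"
  shows "\<P>(\<omega> in M. \<exists>n. B n \<omega> \<le> W n \<omega>) \<le> 2 * (real_of_int w0 / real_of_int (b0 + w0))"
proof -
  let ?H = "history 0 (\<lambda>_. b0) (\<lambda>_. w0)"
  have "prob ?H = 1"
    using initial by (subst prob_eq_1) (auto simp: history_def)
  have bound: "prob (lose_majority_within 0 N) \<le> 2 * (real_of_int w0 / real_of_int (b0 + w0))" for N
  proof -
    have "prob (lose_majority_within 0 N) = prob (?H \<inter> lose_majority_within 0 N)"
      using \<open>prob ?H = 1\<close> measure_space_inter[of "lose_majority_within 0 N" ?H]
      by (simp add: prob_space Int_commute)
    then show ?thesis
      using lose_majority_within_le[of "\<lambda>_. b0" 0 "\<lambda>_. w0" N] assms \<open>prob ?H = 1\<close> by simp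
  qed
  have "(\<lambda>N. prob (lose_majority_within 0 N)) \<longlonglongrightarrow> prob (\<Union>N. lose_majority_within 0 N)"
    by (rule finite_Lim_measure_incseq)
      (auto simp: incseq_def lose_majority_within_def intro: order_trans)
  moreover have "(\<Union>N. lose_majority_within 0 N) = {\<omega> \<in> space M. \<exists>n. B n \<omega> \<le> W n \<omega>}"
    by (auto simp: lose_majority_within_def)
  ultimately show ?thesis
    using bound by (auto intro: LIMSEQ_le_const2)
qed

end

theorem theorem1:
  fixes M :: "'a measure"
    and m_b m_w b0 w0 :: int
    and B W :: "nat \<Rightarrow> 'a \<Rightarrow> int"
  assumes "m_b > 0" and "m_w > 0"
    and "polya_urn M m_b m_w b0 w0 B W"
    and "m_b \<ge> m_w"
    and "b0 > w0" and "w0 \<ge> 0"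
  shows "\<P>(\<omega> in M. \<forall>n. B n \<omega> > W n \<omega>) > 0"
proof -
  interpret polya_urn M m_b m_w b0 w0 B W
    by fact
  have "\<P>(\<omega> in M. \<exists>n. B n \<omega> \<le> W n \<omega>) \<le> 2 * (real_of_int w0 / real_of_int (b0 + w0))"
    using assms by (intro prob_lose_majority_le) auto
  also have "\<dots> < 1"
    using assms(5,6) by (simp add: field_simps)
  finally have "\<P>(\<omega> in M. \<exists>n. B n \<omega> \<le> W n \<omega>) < 1" .
  moreover have "\<P>(\<omega> in M. \<forall>n. B n \<omega> > W n \<omega>) = 1 - \<P>(\<omega> in M. \<exists>n. B n \<omega> \<le> W n \<omega>)"
    using prob_neg[of "\<lambda>\<omega>. \<exists>n. B n \<omega> \<le> W n \<omega>"] by (simp add: not_le)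
  ultimately show ?thesis
    by simp
qed

end
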